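(* A graph $G$ is a $2$-distance graph if and only if $G$ is not spanned by a double-star.
   Context: All graphs are finite and simple, but not necessarily connected. For vertices $u,v$ of a graph $X$, $\mathrm{dist}_X(u,v)$ is the length of a shortest $u$-$v$ path in $X$ ($\infty$ if $u$ and $v$ lie in different components). The $2$-distance graph $T_2(X)$ of $X$ is the graph with vertex set $V(X)$ in which $u,v$ are adjacent if and only if $\mathrm{dist}_X(u,v)=2$. A graph $G$ is called a $2$-distance graph if there exists a graph $X$ with $T_2(X)=G$, where equality refers to graph isomorphism. For a vertex $u$ of a graph $X$, a star centered at $u$ is a subgraph of $X$ consisting of edges that have $u$ as a common vertex. For an edge $uv$ of $X$, a double-star on $uv$ (or simply a double-star) is a maximal tree in $X$ that is the union of stars centered at $u$ or $v$ such that both stars contain the edge $uv$. A subgraph $Y$ of $X$ spans $X$ if $V(Y)=V(X)$; $X$ is spanned by a double-star if some double-star in $X$ spans $X$. *)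

theory Defs
  imports "Graph_Theory.Graph_Theory"
begin

text \<open>
  Finite simple graphs are the library's \<^locale>\<open>pair_graph\<close>s: finite, loop-free, symmetric
  digraphs whose arcs are pairs of vertices, so that an undirected edge $uv$ is the pair of arcs
  \<^term>\<open>(u, v)\<close> and \<^term>\<open>(v, u)\<close>. The null graph is allowed.
\<close>

definition graph_dist :: "'a pair_pre_digraph \<Rightarrow> 'a \<Rightarrow> 'a \<Rightarrow> ereal" where
  "graph_dist X u v = wf_digraph.\<mu> X (\<lambda>_. 1) u v"

definition two_distance_graph :: "'a pair_pre_digraph \<Rightarrow> 'a pair_pre_digraph" where
  "two_distance_graph X =
     \<lparr> pverts = pverts X,
       parcs = {(u, v). u \<in> pverts X \<and> v \<in> pverts X \<and> graph_dist X u v = 2} \<rparr>"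

text \<open>
  HOL cannot quantify over the vertex type of \<open>X\<close>. Taking it to be that of \<open>G\<close> is no
  restriction, see \<open>is_two_distance_graphI\<close> below.
\<close>
definition is_two_distance_graph :: "'a pair_pre_digraph \<Rightarrow> bool" where
  "is_two_distance_graph G \<longleftrightarrow>
     (\<exists>X :: 'a pair_pre_digraph. pair_graph X \<and> digraph_iso (two_distance_graph X) G)"

text \<open>
  The library's \<^const>\<open>tree\<close> is not the undirected notion: in a symmetric digraph it counts
  the closed walk $a, b, a$ along a single edge as a cycle.
\<close>
definition undirected_tree :: "'a pair_pre_digraph \<Rightarrow> bool" where
  "undirected_tree Y \<longleftrightarrow>
     pair_graph Y \<and> connected Y \<and> \<not> (\<exists>p. pre_digraph.cycle Y p \<and> 3 \<le> length p)"

definition star_at :: "'a pair_pre_digraph \<Rightarrow> 'a \<Rightarrow> 'a pair_pre_digraph \<Rightarrow> bool" where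
  "star_at X u S \<longleftrightarrow>
     pair_graph S \<and> subgraph S X \<and> pverts S = Field (parcs S) \<and>
     (\<forall>(a, b) \<in> parcs S. a = u \<or> b = u)"

definition star_union_tree ::
  "'a pair_pre_digraph \<Rightarrow> 'a \<Rightarrow> 'a \<Rightarrow> 'a pair_pre_digraph \<Rightarrow> bool" where
  "star_union_tree X u v Y \<longleftrightarrow>
     undirected_tree Y \<and>
     (\<exists>S T. star_at X u S \<and> star_at X v T \<and> (u, v) \<in> parcs S \<and> (u, v) \<in> parcs T \<and>
        with_proj Y = Digraph_Component.union S T)"

definition double_star ::
  "'a pair_pre_digraph \<Rightarrow> 'a \<Rightarrow> 'a \<Rightarrow> 'a pair_pre_digraph \<Rightarrow> bool" where
  "double_star X u v Y \<longleftrightarrow>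
     (u, v) \<in> parcs X \<and> star_union_tree X u v Y \<and>
     (\<forall>Z. star_union_tree X u v Z \<and> subgraph Y Z \<longrightarrow> Z = Y)"

definition spanned_by_double_star :: "'a pair_pre_digraph \<Rightarrow> bool" where
  "spanned_by_double_star X \<longleftrightarrow> (\<exists>u v Y. double_star X u v Y \<and> spanning Y X)"

lemma graph_dist_iso:
  assumes X: "pair_graph X" and hom: "pre_digraph.digraph_isomorphism (with_proj X) h"
    and X': "app_iso h (with_proj X) = with_proj X'"
    and u: "u \<in> pverts X" and v: "v \<in> pverts X"
  shows "graph_dist X' (iso_verts h u) (iso_verts h v) = graph_dist X u v"
proof -
  interpret X: pair_graph X by (rule X)
  interpret X': wf_digraph "with_proj X'"
    using X.wf_digraphI_app_iso[OF hom] unfolding X' by simp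
  have len: "X.awalk_cost (\<lambda>_. 1) p = length p" "X'.awalk_cost (\<lambda>_. 1) q = length q" for p q
    by (simp_all add: X.awalk_cost_def X'.awalk_cost_def sum_list_triv)
  have "(\<lambda>p. ereal (length p)) ` {p. X'.awalk (iso_verts h u) p (iso_verts h v)} =
        (\<lambda>p. ereal (length p)) ` {p. X.awalk u p v}" (is "?L = ?R")
  proof (intro equalityI subsetI)
    fix x assume "x \<in> ?L"
    then obtain p where p: "X'.awalk (iso_verts h u) p (iso_verts h v)" "x = ereal (length p)"
      by auto
    have "X.awalk (iso_verts (X.inv_iso h) (iso_verts h u)) (map (iso_arcs (X.inv_iso h)) p)
        (iso_verts (X.inv_iso h) (iso_verts h v))"
      using X.awalk_app_isoD[OF _ hom] p(1) unfolding X' by blast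
    then have "X.awalk u (map (iso_arcs (X.inv_iso h)) p) v"
      using X.iso_verts_inv_iso[OF hom] u v by simp
    then show "x \<in> ?R" using p(2)
      by (intro image_eqI[where x = "map (iso_arcs (X.inv_iso h)) p"]) auto
  next
    fix x assume "x \<in> ?R"
    then obtain p where p: "X.awalk u p v" "x = ereal (length p)" by auto
    have "X'.awalk (iso_verts h u) (map (iso_arcs h) p) (iso_verts h v)"
      using X.awalk_app_isoI[OF p(1) hom] unfolding X' .
    then show "x \<in> ?L" using p(2)
      by (intro image_eqI[where x = "map (iso_arcs h) p"]) auto
  qed
  then show ?thesis
    unfolding graph_dist_def X.\<mu>_def X'.\<mu>_def len by simp
qed

lemma is_two_distance_graphI:
  fixes X :: "'b pair_pre_digraph" and G :: "'a pair_pre_digraph"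
  assumes X: "pair_graph X" and iso: "digraph_iso (two_distance_graph X) G"
  shows "is_two_distance_graph G"
proof -
  interpret X: pair_graph X by (rule X)
  let ?T = "two_distance_graph X"
  obtain g where g: "pre_digraph.digraph_isomorphism (with_proj ?T) g"
    and G: "with_proj G = app_iso g (with_proj ?T)"
    using iso unfolding digraph_iso_def by blast
  define f where "f = iso_verts g"
  have inj: "inj_on f (pverts X)"
    using g unfolding pre_digraph.digraph_isomorphism_def f_def two_distance_graph_def by simp
  have proj: "iso_tail g = fst" "iso_head g = snd"
    using arg_cong[OF G, of tail] arg_cong[OF G, of head] by simp_all
  have arcs_g: "iso_arcs g a = map_prod f f a" if "a \<in> parcs ?T" for a
    using g that unfolding pre_digraph.digraph_isomorphism_def proj f_def by (auto intro: prod_eqI)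
  have vG: "pverts G = f ` pverts X"
    using arg_cong[OF G, of verts] by (simp add: f_def two_distance_graph_def)
  have aG: "parcs G = map_prod f f ` parcs ?T"
    using arg_cong[OF G, of arcs] arcs_g by simp
  define X' where "X' = \<lparr> pverts = f ` pverts X, parcs = map_prod f f ` parcs X \<rparr>"
  define h where "h = \<lparr> iso_verts = f, iso_arcs = map_prod f f, iso_head = snd, iso_tail = fst \<rparr>"
  have arcsX: "parcs X \<subseteq> pverts X \<times> pverts X"
    using X.wellformed' by auto
  have hom: "pre_digraph.digraph_isomorphism (with_proj X) h"
    unfolding pre_digraph.digraph_isomorphism_def
    using X.wf_digraph inj inj_on_subset[OF map_prod_inj_on[OF inj inj] arcsX]
    by (auto simp: h_def)
  have X'_app: "app_iso h (with_proj X) = with_proj X'"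
    by (simp add: app_iso_def with_proj_def h_def X'_def)
  have "pair_graph X'"
  proof
    show "\<And>e. e \<in> parcs X' \<Longrightarrow> fst e \<in> pverts X'" "\<And>e. e \<in> parcs X' \<Longrightarrow> snd e \<in> pverts X'"
      using arcsX by (auto simp: X'_def)
    show "finite (pverts X')" "finite (parcs X')"
      by (simp_all add: X'_def X.pair_finite_verts X.pair_finite_arcs)
    show "\<And>e. e \<in> parcs X' \<Longrightarrow> fst e \<noteq> snd e"
      using X.wellformed' X.no_loops' inj_onD[OF inj] by (fastforce simp: X'_def)
    show "symmetric (with_proj X')"
      using X.arcs_symmetric by (auto simp: symmetric_def sym_def X'_def)
  qed
  moreover have "two_distance_graph X' = G"
  proof -
    have dist: "graph_dist X' (f a) (f b) = graph_dist X a b"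
      if "a \<in> pverts X" "b \<in> pverts X" for a b
      using graph_dist_iso[OF X hom X'_app that] by (simp add: h_def)
    have "parcs (two_distance_graph X') = map_prod f f ` parcs ?T"
    proof -
      have "pverts X' = f ` pverts X" by (simp add: X'_def)
      then show ?thesis
        by (auto simp: two_distance_graph_def dist intro!: image_eqI[where f = "map_prod f f"])
    qed
    then show ?thesis
      using vG aG by (simp add: two_distance_graph_def X'_def)
  qed
  moreover have "digraph_iso (with_proj G) (with_proj G)"
  proof -
    have "wf_digraph (with_proj ?T)"
      using g unfolding pre_digraph.digraph_isomorphism_def by blast
    with iso show ?thesis
      using digraph_iso_swap digraph_iso_trans by blast
  qed
  ultimately show ?thesis
    unfolding is_two_distance_graph_def by auto
qed

end

theory Submission
  imports Defs
begin

text \<open>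
  A double-star on an edge \<open>uv\<close> is maximal, so it reaches every neighbour of \<open>u\<close> and every neighbour
  of \<open>v\<close>. Hence \<open>G\<close> is spanned by a double-star if and only if it has an edge \<open>uv\<close> such that every
  vertex is adjacent to \<open>u\<close> or \<open>v\<close>, a \<open>dominating_edge\<close>; this translation is
  \<open>spanning_double_star_imp_dominating_edge\<close> and \<open>dominating_edge_imp_spanned_by_double_star\<close>.

  A two-distance graph \<open>T\<^sub>2(X)\<close> has no dominating edge: if \<open>uv\<close> is an edge of it, then \<open>u\<close> and \<open>v\<close> have a
  common neighbour \<open>w\<close> in \<open>X\<close>, and \<open>w\<close>, being at distance one from both in \<open>X\<close>, is adjacent to neither
  of them in \<open>T\<^sub>2(X)\<close> (\<open>two_distance_graph_not_dominating_edge\<close>).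

  Conversely, if \<open>G\<close> has no dominating edge, then \<open>G\<close> is the two-distance graph of its own
  complement. Vertices at distance two in the complement are distinct and non-adjacent there, hence
  adjacent in \<open>G\<close>. An edge \<open>uv\<close> of \<open>G\<close> fails to dominate some vertex \<open>w\<close>, which is then a common
  neighbour of \<open>u\<close> and \<open>v\<close> in the complement (\<open>two_distance_graph_complement\<close>).
\<close>

section \<open>Dominating edges\<close>

text \<open>
  The quantifier may range over \<open>u\<close> and \<open>v\<close> as well: in a symmetric graph each of the two endpoints
  is adjacent to the other.
\<close>
definition dominating_edge :: "'a pair_pre_digraph \<Rightarrow> 'a \<Rightarrow> 'a \<Rightarrow> bool" where
  "dominating_edge G u v \<longleftrightarrow>
     (u, v) \<in> parcs G \<and> (\<forall>w \<in> pverts G. (u, w) \<in> parcs G \<or> (v, w) \<in> parcs G)"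

section \<open>Distance two\<close>

lemma (in pair_wf_digraph) le_graph_dist_iff:
  "ereal (real n) \<le> graph_dist G u v \<longleftrightarrow> (\<forall>p. awalk u p v \<longrightarrow> n \<le> length p)"
  by (simp add: graph_dist_def \<mu>_def le_INF_iff awalk_cost_def sum_list_triv)

text \<open>
  Distances are infima of walk lengths. That the infimum equals two is split into two bounds:
  it is at least two if and only if there is no walk of length zero or one, and given this, it is
  below three if and only if there is a walk of length two.
\<close>
lemma (in pair_wf_digraph) graph_dist_eq_2_iff:
  assumes u: "u \<in> pverts G"
  shows "graph_dist G u v = 2 \<longleftrightarrow>
    u \<noteq> v \<and> (u, v) \<notin> parcs G \<and> (\<exists>w. (u, w) \<in> parcs G \<and> (w, v) \<in> parcs G)"
proof -
  have le2: "2 \<le> graph_dist G u v \<longleftrightarrow> u \<noteq> v \<and> (u, v) \<notin> parcs G"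
  proof -
    have "2 \<le> graph_dist G u v \<longleftrightarrow> (\<forall>p. awalk u p v \<longrightarrow> 2 \<le> length p)"
      using le_graph_dist_iff[of 2 u v] by simp
    also have "\<dots> \<longleftrightarrow> \<not> awalk u [] v \<and> (\<forall>e. \<not> awalk u [e] v)"
    proof -
      have "2 \<le> length p \<longleftrightarrow> p \<noteq> [] \<and> (\<forall>e. p \<noteq> [e])" for p :: "('a \<times> 'a) list"
        by (cases p rule: remdups_adj.cases) auto
      then show ?thesis by blast
    qed
    also have "\<dots> \<longleftrightarrow> u \<noteq> v \<and> (u, v) \<notin> parcs G"
      using u by (auto simp: awalk_simps dest: in_arcsD2)
    finally show ?thesis .
  qed
  show ?thesis
  proof
    assume d: "graph_dist G u v = 2"
    \<comment> \<open>As the distance is below three, it is attained by a walk of length at most two.\<close>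
    then have "\<not> ereal (real 3) \<le> graph_dist G u v" by simp
    then obtain p where p: "awalk u p v" "\<not> 3 \<le> length p"
      unfolding le_graph_dist_iff by blast
    moreover have "2 \<le> length p"
      using d p(1) le_graph_dist_iff[of 2 u v] by simp
    ultimately have "length p = 2" by simp
    then obtain e f where "p = [e, f]"
      by (auto simp: numeral_2_eq_2 length_Suc_conv)
    then have "(u, snd e) \<in> parcs G" "(snd e, v) \<in> parcs G"
      using p(1) by (cases e; cases f; auto simp: awalk_simps)+
    then show "u \<noteq> v \<and> (u, v) \<notin> parcs G \<and> (\<exists>w. (u, w) \<in> parcs G \<and> (w, v) \<in> parcs G)"
      using d le2 by auto
  next
    assume r: "u \<noteq> v \<and> (u, v) \<notin> parcs G \<and> (\<exists>w. (u, w) \<in> parcs G \<and> (w, v) \<in> parcs G)"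
    then obtain w where "(u, w) \<in> parcs G" "(w, v) \<in> parcs G" by blast
    then have "awalk u [(u, w), (w, v)] v"
      by (auto simp: awalk_simps dest: in_arcsD1 in_arcsD2)
    from min_cost_le_walk_cost[OF this, of "\<lambda>_. 1"] have "graph_dist G u v \<le> 2"
      by (simp add: graph_dist_def)
    with r le2 show "graph_dist G u v = 2" by (auto intro: antisym)
  qed
qed

lemma (in pair_wf_digraph) two_distance_graph_arc_iff:
  "(u, v) \<in> parcs (two_distance_graph G) \<longleftrightarrow>
    u \<in> pverts G \<and> u \<noteq> v \<and> (u, v) \<notin> parcs G \<and> (\<exists>w. (u, w) \<in> parcs G \<and> (w, v) \<in> parcs G)"
proof (cases "u \<in> pverts G")
  case True
  then show ?thesis
    by (auto simp only: two_distance_graph_def graph_dist_eq_2_iff pair_pre_digraph.simps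
        dest: in_arcsD2)
qed (simp add: two_distance_graph_def)

section \<open>Two-distance graphs have no dominating edge\<close>

text \<open>
  An isomorphism in the library maps vertices and arcs by two separate functions; between graphs whose
  arcs are pairs of vertices, the vertex map determines the arc map.
\<close>
lemma digraph_iso_pairE:
  assumes "digraph_iso (with_proj T) (with_proj G)"
  obtains f where "inj_on f (pverts T)" "pverts G = f ` pverts T"
    "parcs G = map_prod f f ` parcs T" "parcs T \<subseteq> pverts T \<times> pverts T"
proof -
  obtain g where g: "pre_digraph.digraph_isomorphism (with_proj T) g"
    and G: "with_proj G = app_iso g (with_proj T)"
    using assms unfolding digraph_iso_def by blast
  have proj: "iso_tail g = fst" "iso_head g = snd"
    using arg_cong[OF G, of tail] arg_cong[OF G, of head] by simp_all
  have "iso_arcs g a = map_prod (iso_verts g) (iso_verts g) a" if "a \<in> parcs T" for a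
    using g that unfolding pre_digraph.digraph_isomorphism_def proj by (auto intro: prod_eqI)
  then have "parcs G = map_prod (iso_verts g) (iso_verts g) ` parcs T"
    using arg_cong[OF G, of arcs] by simp
  moreover have "inj_on (iso_verts g) (pverts T)" "wf_digraph (with_proj T)"
    using g unfolding pre_digraph.digraph_isomorphism_def by simp_all
  moreover have "pverts G = iso_verts g ` pverts T"
    using arg_cong[OF G, of verts] by simp
  ultimately show thesis
    using that[of "iso_verts g"] by (fastforce simp: wf_digraph_def)
qed

lemma dominating_edge_iso:
  assumes iso: "digraph_iso (with_proj T) (with_proj G)" and dom: "dominating_edge G u v"
  shows "\<exists>a b. dominating_edge T a b"
proof -
  obtain f where f: "inj_on f (pverts T)" "pverts G = f ` pverts T"
    "parcs G = map_prod f f ` parcs T" "parcs T \<subseteq> pverts T \<times> pverts T"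
    using digraph_iso_pairE[OF iso] .
  obtain a b where ab: "(a, b) \<in> parcs T" "u = f a" "v = f b"
    using dom f(3) by (auto simp: dominating_edge_def)
  have reflects: "(x, y) \<in> parcs T"
    if "(f x, f y) \<in> parcs G" "x \<in> pverts T" "y \<in> pverts T" for x y
  proof -
    obtain x' y' where "(x', y') \<in> parcs T" "f x = f x'" "f y = f y'"
      using \<open>(f x, f y) \<in> parcs G\<close> f(3) by auto
    moreover from this have "x' \<in> pverts T" "y' \<in> pverts T" using f(4) by auto
    ultimately show ?thesis using that f(1) by (metis inj_onD)
  qed
  have "a \<in> pverts T" "b \<in> pverts T" using ab f(4) by auto
  then have "dominating_edge T a b"
    using dom ab f(2) reflects unfolding dominating_edge_def by blast
  then show ?thesis by blast
qed

text \<open>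
  Vertices at distance two in \<open>X\<close> have a common neighbour in \<open>X\<close>, and the distance from it to either
  of them is one, not two.
\<close>
lemma two_distance_graph_not_dominating_edge:
  assumes "pair_graph X"
  shows "\<not> dominating_edge (two_distance_graph X) u v"
proof
  assume dom: "dominating_edge (two_distance_graph X) u v"
  interpret X: pair_graph X by fact
  have "(u, v) \<in> parcs (two_distance_graph X)"
    using dom by (simp add: dominating_edge_def)
  then obtain w where w: "(u, w) \<in> parcs X" "(w, v) \<in> parcs X"
    unfolding X.two_distance_graph_arc_iff by blast
  then have vw: "(v, w) \<in> parcs X" using X.arcs_symmetric by blast
  have "w \<in> pverts (two_distance_graph X)"
    using w by (auto simp: two_distance_graph_def dest: X.in_arcsD2)
  then have "(u, w) \<in> parcs (two_distance_graph X) \<or> (v, w) \<in> parcs (two_distance_graph X)"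
    using dom by (auto simp: dominating_edge_def)
  then show False using w(1) vw unfolding X.two_distance_graph_arc_iff by blast
qed

section \<open>Complements\<close>

definition complement :: "'a pair_pre_digraph \<Rightarrow> 'a pair_pre_digraph" where
  "complement G =
     \<lparr> pverts = pverts G,
       parcs = {(u, v). u \<in> pverts G \<and> v \<in> pverts G \<and> u \<noteq> v \<and> (u, v) \<notin> parcs G} \<rparr>"

lemma pair_graph_complement:
  assumes "pair_graph G"
  shows "pair_graph (complement G)"
proof -
  interpret G: pair_graph G by fact
  have "parcs (complement G) \<subseteq> pverts G \<times> pverts G" by (auto simp: complement_def)
  then have "finite (parcs (complement G))"
    using G.pair_finite_verts by (meson finite_SigmaI finite_subset)
  then show ?thesis
    using G.pair_finite_verts G.arcs_symmetric
    by unfold_locales (auto simp: complement_def symmetric_def sym_def)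
qed

text \<open>
  A vertex that witnesses that an edge \<open>uv\<close> is not dominating is precisely the midpoint of a path of
  length two from \<open>u\<close> to \<open>v\<close> in the complement.
\<close>
lemma two_distance_graph_complement:
  assumes G: "pair_graph G" and "\<nexists>u v. dominating_edge G u v"
  shows "two_distance_graph (complement G) = G"
proof -
  interpret G: pair_graph G by fact
  interpret C: pair_graph "complement G" by (rule pair_graph_complement[OF G])
  have verts: "pverts (complement G) = pverts G" by (simp add: complement_def)
  have "(u, v) \<in> parcs (two_distance_graph (complement G)) \<longleftrightarrow> (u, v) \<in> parcs G" for u v
  proof
    assume "(u, v) \<in> parcs (two_distance_graph (complement G))"
    then show "(u, v) \<in> parcs G"
      unfolding C.two_distance_graph_arc_iff by (auto simp: complement_def)
  next
    assume e: "(u, v) \<in> parcs G"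
    then obtain w where w: "w \<in> pverts G" "(u, w) \<notin> parcs G" "(v, w) \<notin> parcs G"
      using assms(2) by (auto simp: dominating_edge_def)
    have uv: "u \<in> pverts G" "v \<in> pverts G" using e by (auto dest: G.in_arcsD1 G.in_arcsD2)
    have "u \<noteq> v" "w \<noteq> v" "w \<noteq> u" "(w, v) \<notin> parcs G"
      using e w G.no_loops' G.arcs_symmetric by blast+
    then show "(u, v) \<in> parcs (two_distance_graph (complement G))"
      using uv e w unfolding C.two_distance_graph_arc_iff by (auto simp: complement_def)
  qed
  then have "parcs (two_distance_graph (complement G)) = parcs G"
    by auto
  then show ?thesis
    by (simp add: two_distance_graph_def verts)
qed

lemma digraph_iso_refl:
  assumes "wf_digraph G"
  shows "digraph_iso G G"
proof -
  interpret wf_digraph G by fact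
  let ?h = "\<lparr> iso_verts = id, iso_arcs = id, iso_head = head G, iso_tail = tail G \<rparr>"
  have "digraph_isomorphism ?h"
    using assms by (auto simp: digraph_isomorphism_def)
  moreover have "G = app_iso ?h G" by (simp add: app_iso_def)
  ultimately show ?thesis unfolding digraph_iso_def by blast
qed

section \<open>Double-stars\<close>

text \<open>
  Every vertex of a star is its centre or a neighbour of the centre, and the two centres are adjacent.
\<close>
lemma spanning_double_star_imp_dominating_edge:
  assumes G: "pair_graph G" and ds: "double_star G u v Y" and span: "spanning Y G"
  shows "dominating_edge G u v"
proof -
  interpret G: pair_graph G by fact
  obtain S T where S: "star_at G u S" and T: "star_at G v T"
    and Y: "with_proj Y = Digraph_Component.union S T"
    using ds by (auto simp: double_star_def star_union_tree_def)
  have uv: "(u, v) \<in> parcs G" using ds by (simp add: double_star_def)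
  then have vu: "(v, u) \<in> parcs G" using G.arcs_symmetric by blast
  have star: "w = c \<or> (c, w) \<in> parcs G" if R: "star_at G c R" and w: "w \<in> pverts R" for c R w
  proof -
    have sub: "parcs R \<subseteq> parcs G" using R by (simp add: star_at_def subgraph_def)
    obtain x where "(x, w) \<in> parcs R \<or> (w, x) \<in> parcs R"
      using R w unfolding star_at_def Field_def by blast
    moreover from this have "x = c \<or> w = c" using R unfolding star_at_def by blast
    ultimately show ?thesis using sub G.arcs_symmetric by blast
  qed
  have "pverts G = pverts S \<union> pverts T"
    using span arg_cong[OF Y, of verts] by (simp add: spanning_def union_def)
  then show ?thesis
    using star[OF S] star[OF T] uv vu unfolding dominating_edge_def by blast
qed

definition star :: "'a \<Rightarrow> 'a set \<Rightarrow> 'a pair_pre_digraph" where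
  "star c A = \<lparr> pverts = insert c A, parcs = {c} \<times> A \<union> A \<times> {c} \<rparr>"

lemma star_at_star:
  assumes G: "pair_graph G" and A: "\<And>a. a \<in> A \<Longrightarrow> (c, a) \<in> parcs G" "A \<noteq> {}"
  shows "star_at G c (star c A)"
proof -
  interpret G: pair_graph G by fact
  have sub: "pverts (star c A) \<subseteq> pverts G" "parcs (star c A) \<subseteq> parcs G"
    using A G.arcs_symmetric by (auto simp: star_def dest: G.in_arcsD1 G.in_arcsD2)
  have "c \<notin> A" using A G.no_loops' by blast
  then have graph: "pair_graph (star c A)"
    using finite_subset[OF sub(1) G.pair_finite_verts] finite_subset[OF sub(2) G.pair_finite_arcs]
    by unfold_locales (auto simp: star_def symmetric_def sym_def)
  then interpret S: pair_graph "star c A" .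
  have "subgraph (star c A) G"
    using sub G.wf_digraph S.wf_digraph by (auto simp: subgraph_def)
  with graph A(2) show ?thesis
    by (auto simp: star_at_def star_def Field_def)
qed

text \<open>
  The only vertices of a double-star with more than one neighbour are its two centres, so it
  contains no cycle of length at least three once such cycles are known to have three vertices
  with two distinct neighbours each. The first vertex \<open>u\<close> of the cycle and its two successors serve
  for this; the predecessor of \<open>u\<close> is the tail of the last arc.
\<close>
lemma (in pair_wf_digraph) long_cycle_three_vertices:
  assumes "cycle p" "3 \<le> length p"
  shows "\<exists>a b c. distinct [a, b, c] \<and> (\<forall>x \<in> {a, b, c}.
    \<exists>y z. y \<noteq> z \<and> (y, x) \<in> parcs G \<and> (x, z) \<in> parcs G)"
proof -
  obtain u where w: "awalk u p u" and d: "distinct (tl (pawalk_verts u p))"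
    using assms(1) by (auto simp: cycle_def)
  obtain e f g q where p: "p = e # f # g # q"
    using assms(2) by (auto simp: numeral_3_eq_3 Suc_le_length_iff)
  obtain a b c where e: "e = (u, a)" and f: "f = (a, b)" and g: "g = (b, c)"
    using w by (cases e; cases f; cases g) (auto simp: p awalk_def)
  have arcs: "(u, a) \<in> parcs G" "(a, b) \<in> parcs G" "(b, c) \<in> parcs G" and q: "awalk c q u"
    using w by (auto simp: p e f g awalk_Cons_iff)
  have d': "distinct (a # b # pawalk_verts c q)" using d by (simp add: p e f g)
  have c: "c \<in> set (pawalk_verts c q)" using set_awalk_verts[OF q] by simp
  have u: "u \<in> set (pawalk_verts c q)" using q by (auto elim!: awalkE simp flip: awlast_if_cas)
  \<comment> \<open>In a triangle the predecessor of \<open>u\<close> is \<open>b\<close>; in a longer cycle it lies beyond \<open>b\<close>.\<close>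
  obtain z where z: "(z, u) \<in> parcs G" "z \<noteq> a"
  proof (cases q rule: rev_cases)
    case Nil
    then show thesis using q arcs d' that[of b] by (auto simp: awalk_Nil_iff)
  next
    case (snoc r h)
    then have "(fst h, u) \<in> parcs G" "fst h \<in> set (pawalk_verts c q)"
      using q set_awalk_verts[OF q] by (auto simp: awalk_simps)
    then show thesis using d' by (intro that[of "fst h"]) auto
  qed
  have "distinct [u, a, b]" using d' u by auto
  moreover have "u \<noteq> b" "a \<noteq> c" using d' c u by auto
  ultimately show ?thesis
    using arcs z by (intro exI[of _ u] exI[of _ a] exI[of _ b]) auto
qed

lemma two_stars_leaf_unique_neighbour:
  assumes "A \<inter> B = {}" "w \<notin> {u, v}"
    and "(y, w) \<in> parcs (star u A) \<union> parcs (star v B)"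
    and "(w, z) \<in> parcs (star u A) \<union> parcs (star v B)"
  shows "y = z"
  using assms by (auto simp: star_def)

text \<open>
  Hang every neighbour of \<open>u\<close> on \<open>u\<close> and every remaining vertex on \<open>v\<close>. This tree is spanning, and it is
  maximal because any further edge of \<open>G\<close> that meets \<open>u\<close> or \<open>v\<close> joins \<open>v\<close> to a neighbour of \<open>u\<close> and so
  closes a triangle.
\<close>
lemma dominating_edge_imp_spanned_by_double_star:
  assumes G: "pair_graph G" and dom: "dominating_edge G u v"
  shows "spanned_by_double_star G"
proof -
  interpret G: pair_graph G by fact
  have uv: "(u, v) \<in> parcs G" "u \<noteq> v" "u \<in> pverts G" "v \<in> pverts G"
    using dom G.no_loops' G.in_arcsD1 G.in_arcsD2 by (auto simp: dominating_edge_def)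
  \<comment> \<open>Note that \<open>v\<close> belongs to \<open>A\<close> and \<open>u\<close> to \<open>B\<close>, so both stars contain the edge \<open>uv\<close>.\<close>
  define A where "A = {w. (u, w) \<in> parcs G}"
  define B where "B = pverts G - A"
  have A: "v \<in> A" "u \<notin> A" "A \<subseteq> pverts G"
    using uv G.no_loops' by (auto simp: A_def dest: G.in_arcsD2)
  have B: "u \<in> B" "v \<notin> B" "\<And>b. b \<in> B \<Longrightarrow> (v, b) \<in> parcs G"
    using A uv dom by (auto simp: B_def A_def dominating_edge_def)
  have AB: "A \<inter> B = {}" "A \<union> B = pverts G"
    using A by (auto simp: B_def)
  let ?S = "star u A" and ?T = "star v B"
  have S: "star_at G u ?S"
    by (rule star_at_star[OF G]) (use A in \<open>auto simp: A_def\<close>)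
  have T: "star_at G v ?T"
    by (rule star_at_star[OF G]) (use B in auto)
  define Y where "Y = \<lparr> pverts = pverts G, parcs = parcs ?S \<union> parcs ?T \<rparr>"
  have union: "with_proj Y = Digraph_Component.union ?S ?T"
    using AB uv A B by (auto simp: Y_def union_def with_proj_def star_def)
  have graph: "pair_graph Y"
  proof -
    interpret S: pair_graph ?S using S by (simp add: star_at_def)
    interpret T: pair_graph ?T using T by (simp add: star_at_def)
    show ?thesis
      using G.pair_finite_verts S.pair_finite_arcs T.pair_finite_arcs uv A B AB
      by unfold_locales (auto simp: Y_def star_def symmetric_def sym_def)
  qed
  interpret Y: pair_graph Y by (rule graph)
  have sub: "subgraph Y G"
    using S T G.wf_digraph Y.wf_digraph by (auto simp: subgraph_def Y_def star_at_def)
  have connected: "connected Y"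
  proof -
    have to_u: "x \<rightarrow>\<^sup>*\<^bsub>with_proj Y\<^esub> u" if "x \<in> pverts Y" for x
    proof (cases "x \<in> A")
      case True
      then have "(x, u) \<in> parcs Y" by (simp add: Y_def star_def)
      then show ?thesis by (intro Y.reachable_adjI) simp
    next
      case False
      then have "(x, v) \<in> parcs Y" using that by (simp add: Y_def star_def B_def)
      moreover have "(v, u) \<in> parcs Y" using A by (simp add: Y_def star_def)
      ultimately show ?thesis
        by (intro Y.reachable_trans[of x v u] Y.reachable_adjI) simp_all
    qed
    have "x \<rightarrow>\<^sup>*\<^bsub>with_proj Y\<^esub> y" if "x \<in> pverts Y" "y \<in> pverts Y" for x y
      using to_u[OF that(1)] symmetric_reachable[OF Y.pair_sym_arcs to_u[OF that(2)]]
      by (rule Y.reachable_trans)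
    then have "x \<rightarrow>\<^sup>*\<^bsub>with_proj (mk_symmetric Y)\<^esub> y" if "x \<in> pverts Y" "y \<in> pverts Y" for x y
      using that Y.reachable_mk_symmetricI by blast
    moreover have "pverts (mk_symmetric Y) = pverts Y" by (simp add: mk_symmetric_def)
    moreover have "u \<in> pverts Y" using uv by (simp add: Y_def)
    ultimately show ?thesis
      unfolding connected_def by (intro strongly_connectedI) auto
  qed
  have acyclic: "\<not> (\<exists>p. Y.cycle p \<and> 3 \<le> length p)"
  proof
    assume "\<exists>p. Y.cycle p \<and> 3 \<le> length p"
    then obtain a b c where abc: "distinct [a, b, c]"
      and nb: "\<forall>x \<in> {a, b, c}. \<exists>y z. y \<noteq> z \<and> (y, x) \<in> parcs Y \<and> (x, z) \<in> parcs Y"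
      using Y.long_cycle_three_vertices by blast
    have "x \<in> {u, v}" if x: "x \<in> {a, b, c}" for x
    proof (rule ccontr)
      assume leaf: "x \<notin> {u, v}"
      obtain y z where "y \<noteq> z" and arcs: "(y, x) \<in> parcs Y" "(x, z) \<in> parcs Y"
        using bspec[OF nb x] by blast
      moreover have "y = z"
        by (rule two_stars_leaf_unique_neighbour[OF AB(1) leaf])
          (use arcs in \<open>simp_all add: Y_def\<close>)
      ultimately show False by blast
    qed
    then have "{a, b, c} \<subseteq> {u, v}" by blast
    then have "card {a, b, c} \<le> card {u, v}" by (intro card_mono) auto
    also have "\<dots> \<le> 2" by (simp add: card_insert_if)
    finally show False using abc by simp
  qed
  have tree: "star_union_tree G u v Y"
    unfolding star_union_tree_def undirected_tree_def
    using graph connected acyclic S T union A B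
    by (intro conjI exI[of _ ?S] exI[of _ ?T]) (auto simp: star_def)
  have "Z = Y" if Z: "star_union_tree G u v Z" and YZ: "subgraph Y Z" for Z
  proof -
    obtain S' T' where S': "star_at G u S'" and T': "star_at G v T'"
      and Z_union: "with_proj Z = Digraph_Component.union S' T'"
      using Z by (auto simp: star_union_tree_def)
    have graphZ: "pair_graph Z" and acyclicZ: "\<And>p. pre_digraph.cycle Z p \<Longrightarrow> \<not> 3 \<le> length p"
      using Z by (auto simp: star_union_tree_def undirected_tree_def)
    interpret Z: pair_graph Z by (rule graphZ)
    have verts: "pverts Z = pverts S' \<union> pverts T'" and arcs: "parcs Z = parcs S' \<union> parcs T'"
      using arg_cong[OF Z_union, of verts] arg_cong[OF Z_union, of arcs]
      by (simp_all add: union_def)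
    have "pverts Z \<subseteq> pverts G" and ZG: "parcs Z \<subseteq> parcs G"
      using S' T' by (auto simp: verts arcs star_at_def subgraph_def)
    moreover have "pverts Y \<subseteq> pverts Z" and YZ': "parcs Y \<subseteq> parcs Z"
      using YZ by (auto simp: subgraph_def)
    ultimately have verts_eq: "pverts Z = pverts Y" by (auto simp: Y_def)
    have at_u: "(u, b) \<in> parcs Y" if "(u, b) \<in> parcs Z" for b
      using that ZG by (auto simp: Y_def star_def A_def)
    have at_v: "(v, b) \<in> parcs Y" if b: "(v, b) \<in> parcs Z" for b
    proof (rule ccontr)
      assume n: "(v, b) \<notin> parcs Y"
      have "b \<in> pverts G" using b ZG by (auto dest: G.in_arcsD2)
      then have "b \<in> A" using n AB by (auto simp: Y_def star_def)
      moreover have "b \<noteq> u" using n A by (auto simp: Y_def star_def)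
      ultimately have "(b, u) \<in> parcs Z" "(u, v) \<in> parcs Z" "b \<noteq> v"
        using YZ' A b Z.no_loops' by (auto simp: Y_def star_def)
      then have "Z.cycle [(u, v), (v, b), (b, u)]"
        using b uv \<open>b \<noteq> u\<close>
        by (auto simp: Z.cycle_def Z.awalk_simps dest: Z.in_arcsD1)
      then show False using acyclicZ by fastforce
    qed
    have "parcs Z \<subseteq> parcs Y"
    proof (rule subrelI)
      fix a b assume ab: "(a, b) \<in> parcs Z"
      then have "a \<in> {u, v} \<or> b \<in> {u, v}"
        using S' T' unfolding arcs star_at_def by blast
      then show "(a, b) \<in> parcs Y"
        using ab at_u at_v Z.arcs_symmetric Y.arcs_symmetric by blast
    qed
    with YZ' verts_eq show "Z = Y" by auto
  qed
  with tree uv have "double_star G u v Y" by (auto simp: double_star_def)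
  moreover have "spanning Y G" using sub by (simp add: spanning_def Y_def)
  ultimately show ?thesis unfolding spanned_by_double_star_def by blast
qed

theorem theorem2p5:
  fixes G :: "'a pair_pre_digraph"
  assumes "pair_graph G"
  shows "is_two_distance_graph G \<longleftrightarrow> \<not> spanned_by_double_star G"
proof -
  interpret pair_graph G by fact
  have spanned: "spanned_by_double_star G \<longleftrightarrow> (\<exists>u v. dominating_edge G u v)"
    using dominating_edge_imp_spanned_by_double_star[OF assms]
      spanning_double_star_imp_dominating_edge[OF assms]
    unfolding spanned_by_double_star_def by blast
  show ?thesis
  proof
    assume "is_two_distance_graph G"
    then obtain X :: "'a pair_pre_digraph" where X: "pair_graph X"
      and iso: "digraph_iso (two_distance_graph X) G"
      unfolding is_two_distance_graph_def by blast
    show "\<not> spanned_by_double_star G"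
      unfolding spanned
      using dominating_edge_iso[OF iso] two_distance_graph_not_dominating_edge[OF X] by blast
  next
    assume "\<not> spanned_by_double_star G"
    then have "two_distance_graph (complement G) = G"
      using two_distance_graph_complement[OF assms] spanned by blast
    then show "is_two_distance_graph G"
      using pair_graph_complement[OF assms] digraph_iso_refl[OF wf_digraph]
      unfolding is_two_distance_graph_def by metis
  qed
qed

end
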